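(* Let $t_0>0$, $\delta>0$ and $\frac23<r<2$. Let $x:[t_0,+\infty[\to\mathcal H$ be a global solution trajectory of $$\ddot x(t)+\frac{\delta}{t^{r/2}}\dot x(t)+\nabla f(x(t))+\frac{1}{t^r}x(t)=0 .$$ Then $$f(x(t))-\min_{\mathcal H} f=O\left(\frac{1}{t^{\frac{3r}{2}-1}}\right)\ \text{ as } t\to+\infty,\qquad\text{and}\qquad \liminf_{t\to+\infty}\|x(t)-x^*\|=0 .$$
   Context: $\mathcal H$ is a real Hilbert space with scalar product $\langle\cdot,\cdot\rangle$ and norm $\|\cdot\|$. The function $f:\mathcal H\to\mathbb R$ is convex and (continuously) differentiable, and $\nabla f$ is Lipschitz continuous on bounded sets. The solution set $S=\operatorname{argmin} f$ is nonempty, and $x^*$ denotes the element of minimum norm of $S$. Solutions are classical (twice differentiable) solutions on $[t_0,+\infty[$. *)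

theory Defs
  imports "HOL-Analysis.Analysis" "HOL-Library.Landau_Symbols"
begin

definition argmin :: "('a \<Rightarrow> real) \<Rightarrow> 'a set" where
  "argmin f = {y. is_arg_min f (\<lambda>_. True) y}"

text \<open>
  For a convex continuous \<open>f\<close> on a Hilbert space with \<open>argmin f\<close> nonempty, the element of minimum
  norm of \<open>argmin f\<close> exists and is unique, so the choice made by \<^const>\<open>arg_min_on\<close> is
  the intended point.
\<close>
definition min_norm_minimizer :: "('a::real_normed_vector \<Rightarrow> real) \<Rightarrow> 'a" where
  "min_norm_minimizer f = arg_min_on norm (argmin f)"

text \<open>
  Classical global solutions on \<open>[t0, \<infinity>[\<close> of
  \<open>x'' + (\<delta> / t\<^bsup>r/2\<^esup>) x' + \<nabla>f(x) + (1 / t\<^bsup>r\<^esup>) x = 0\<close>, where \<open>g\<close> is the gradient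
  of \<open>f\<close>. Derivatives are taken within \<open>[t0, \<infinity>[\<close>, hence one-sided at \<open>t0\<close>; values of \<open>x\<close>
  before \<open>t0\<close> are irrelevant.
\<close>
definition solution_trajectory ::
    "('a::real_normed_vector \<Rightarrow> 'a) \<Rightarrow> real \<Rightarrow> real \<Rightarrow> real \<Rightarrow> (real \<Rightarrow> 'a) \<Rightarrow> bool" where
  "solution_trajectory g \<delta> r t0 x \<longleftrightarrow>
    (\<exists>x' x''. \<forall>t\<ge>t0.
      (x has_vector_derivative x' t) (at t within {t0..}) \<and>
      (x' has_vector_derivative x'' t) (at t within {t0..}) \<and>
      x'' t + (\<delta> / t powr (r / 2)) *\<^sub>R x' t + g (x t) + (1 / t powr r) *\<^sub>R x t = 0)"

end

theory Submission imports Defs "HOL-Real_Asymp.Real_Asymp" begin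

text \<open>
  Put \<open>s = t\<^bsup>-r/2\<^esup>\<close>, \<open>c = \<delta> s / 2\<close>, let \<open>p\<close> be the minimizer of \<open>f\<close> of least norm, and write
  \<open>u = x - p\<close>, \<open>v = x'\<close>. The equation is a damped gradient system for the regularized function
  \<open>f + (s\<^sup>2/2) |.|\<^sup>2\<close>, which is \<open>s\<^sup>2\<close>-strongly convex, with damping \<open>2c\<close>; for frozen \<open>s\<close> such a
  system relaxes at an exponential rate proportional to \<open>s\<close>. Since \<open>r < 2\<close>, the coefficients vary
  slowly (\<open>|s'|/s\<close> is of order \<open>1/t\<close>, which is \<open>o(s)\<close>), so this relaxation survives.

  It is measured by the energy \<open>E = G + |c u + v|\<^sup>2/2 + c\<^sup>2 |u|\<^sup>2/2\<close>, where
  \<open>G = f(x) - f(p) + (s\<^sup>2/2) (|x|\<^sup>2 - |p|\<^sup>2)\<close> is the excess of the regularized function over its value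
  at the fixed point \<open>p\<close>. Anchoring at \<open>p\<close> rather than at the moving minimizer of the regularized
  function avoids differentiating the latter; the price is that \<open>G\<close> may be negative. The lemma
  \<open>energy_dissipation\<close> gives, for some \<open>0 < q \<le> 1/2\<close> and large \<open>t\<close>,
  \<open>E' \<le> - q c E - (1 - q) c G + O(s\<^sup>2/t)\<close>. Hence a lower bound \<open>G \<ge> - \<kappa> s\<^sup>2\<close> is turned into an upper
  bound \<open>E \<le> K \<kappa> s\<^sup>2\<close>, with \<open>K\<close> independent of \<open>\<kappa>\<close> (\<open>energy_eventually_le\<close>). This is used twice.

  Always \<open>G \<ge> - |p|\<^sup>2 s\<^sup>2/2\<close>. So \<open>E = O(s\<^sup>2)\<close>, and therefore \<open>f(x) - f(p) = O(t\<^bsup>-r\<^esup>)\<close>, which implies the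
  stated rate because \<open>3r/2 - 1 < r\<close>.

  Consequently \<open>f(x(t))\<close> tends to the minimum. Among points whose value is close to the minimum, the
  norm cannot be much smaller than \<open>|p|\<close> (\<open>min_norm_minimizer_well_posed\<close>), so \<open>G \<ge> - \<kappa> s\<^sup>2\<close> holds
  eventually for every \<open>\<kappa> > 0\<close>. Then \<open>c\<^sup>2 |u|\<^sup>2/2 \<le> E - G \<le> (K + 1) \<kappa> s\<^sup>2\<close>; as \<open>c\<close> is a fixed multiple of
  \<open>s\<close>, this says that \<open>|u|\<^sup>2\<close> is eventually below any positive number. So \<open>x(t)\<close> converges in norm to
  \<open>p\<close>, and in particular the lower limit of the distance is \<open>0\<close>.
\<close>

section \<open>Convexity and minimizers of least norm\<close>

lemma convex_gradient_inequality:
  fixes f :: "'a::real_inner \<Rightarrow> real"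
  assumes cvx: "convex_on UNIV f" and grad: "GDERIV f y :> g"
  shows "f y + inner g (z - y) \<le> f z"
proof -
  define \<phi> where "\<phi> s = f (y + s *\<^sub>R (z - y))" for s :: real
  have "((\<lambda>s. y + s *\<^sub>R (z - y)) has_derivative (\<lambda>s. s *\<^sub>R (z - y))) (at (0::real))"
    by (auto intro!: derivative_eq_intros)
  moreover have "(f has_derivative (\<lambda>h. inner h g)) (at (y + 0 *\<^sub>R (z - y)))"
    using grad by (simp add: gderiv_def)
  ultimately have "(\<phi> has_derivative (\<lambda>s. inner (s *\<^sub>R (z - y)) g)) (at 0)"
    unfolding \<phi>_def by (rule has_derivative_compose)
  then have deriv: "(\<phi> has_real_derivative inner g (z - y)) (at 0)"
    by (rule has_derivative_imp_has_field_derivative) (simp add: inner_commute)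
  have "convex_on UNIV \<phi>"
  proof (rule convex_onI)
    fix t a b :: real assume "0 < t" "t < 1"
    have "y + ((1 - t) *\<^sub>R a + t *\<^sub>R b) *\<^sub>R (z - y)
          = (1 - t) *\<^sub>R (y + a *\<^sub>R (z - y)) + t *\<^sub>R (y + b *\<^sub>R (z - y))"
      by (simp add: algebra_simps)
    then show "\<phi> ((1 - t) *\<^sub>R a + t *\<^sub>R b) \<le> (1 - t) * \<phi> a + t * \<phi> b"
      using convex_onD[OF cvx, of t] \<open>0 < t\<close> \<open>t < 1\<close> unfolding \<phi>_def by simp
  qed simp
  from convex_on_imp_above_tangent[OF this, of 0 1] deriv
  have "\<phi> 1 - \<phi> 0 \<ge> inner g (z - y) * (1 - 0)" by simp
  then show ?thesis by (simp add: \<phi>_def)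
qed

lemma argmin_iff: "p \<in> argmin f \<longleftrightarrow> (\<forall>y. f p \<le> f y)"
  by (auto simp: argmin_def is_arg_min_def not_less)

text \<open>
  Elements of almost least norm in the nested convex sublevel sets \<open>C n = {y. f y \<le> min f + 1/(n+1)}\<close>
  form a Cauchy sequence, by the parallelogram law: the midpoint of two of them stays in the larger
  sublevel set, so its norm is not below the infimum \<open>d n\<close> of the norm there. The limit \<open>p\<close> is a
  minimizer with \<open>|p| = lim (d n)\<close>. This equality gives both minimality of the norm and the last
  claim, which says that \<open>|y|\<close> is almost at least \<open>|p|\<close> as soon as \<open>f y\<close> is almost minimal; the strong
  argument replaces weak compactness and weak lower semicontinuity of the norm.
\<close>

lemma least_norm_minimizer_exists_well_posed:
  fixes f :: "'a::{real_inner, complete_space} \<Rightarrow> real"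
  assumes cvx: "convex_on UNIV f" and cont: "continuous_on UNIV f" and ne: "argmin f \<noteq> {}"
  obtains p where "p \<in> argmin f" "\<And>z. z \<in> argmin f \<Longrightarrow> norm p \<le> norm z"
    "\<And>e. e > 0 \<Longrightarrow> \<exists>\<eta>>0. \<forall>y. f y \<le> f p + \<eta> \<longrightarrow> (norm p)\<^sup>2 - e \<le> (norm y)\<^sup>2"
proof -
  obtain z0 where z0: "z0 \<in> argmin f" using ne by auto
  define m where "m = f z0"
  have m_le: "m \<le> f y" for y using z0 by (simp add: argmin_iff m_def)
  define h where "h n = inverse (real (Suc n))" for n
  have h_pos: "h n > 0" for n by (simp add: h_def)
  have h_anti: "h k \<le> h n" if "n \<le> k" for n k using that by (simp add: h_def)
  have h_lim: "h \<longlonglongrightarrow> 0" unfolding h_def by (rule LIMSEQ_inverse_real_of_nat)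
  define C where "C n = {y. f y \<le> m + h n}" for n
  define d where "d n = (INF y\<in>C n. norm y)" for n
  have min_in_C: "z \<in> C n" if "z \<in> argmin f" for z n
    using that h_pos[of n] by (auto simp: C_def argmin_iff m_def intro: order_trans[of _ "f z0"])
  have C_ne: "C n \<noteq> {}" for n using min_in_C[OF z0] by auto
  have d_le: "d n \<le> norm y" if "y \<in> C n" for y n
    unfolding d_def using that by (intro cINF_lower bdd_belowI2[of _ 0]) auto
  have d_nonneg: "0 \<le> d n" for n
    unfolding d_def using C_ne by (intro cINF_greatest) auto
  have "incseq d"
  proof (rule incseq_SucI)
    fix n
    have "C (Suc n) \<subseteq> C n" using h_anti[of n "Suc n"] by (auto simp: C_def)
    then show "d n \<le> d (Suc n)"
      using C_ne d_le unfolding d_def[of "Suc n"] by (intro cINF_greatest) auto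
  qed
  moreover have "d n \<le> norm z0" for n using d_le[OF min_in_C[OF z0]] .
  ultimately obtain l where d_lim: "d \<longlonglongrightarrow> l" and d_le_l: "\<And>n. d n \<le> l"
    using incseq_convergent[of d "norm z0"] by blast
  have l_nonneg: "0 \<le> l" using d_nonneg[of 0] d_le_l[of 0] by linarith
  have "\<exists>y\<in>C n. norm y < d n + h n" for n
    using cInf_lessD[of "norm ` C n" "d n + h n"] C_ne[of n] h_pos[of n] by (auto simp: d_def)
  then obtain y where yC: "\<And>n. y n \<in> C n" and y_less: "\<And>n. norm (y n) < d n + h n" by metis
  have y_le: "norm (y k) \<le> l + h n" if "n \<le> k" for n k
    using y_less[of k] d_le_l[of k] h_anti[OF that] by linarith
  \<comment> \<open>\<open>w n\<close> bounds the squared diameter of the tail of \<open>y\<close> that starts at \<open>n\<close>.\<close>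
  define w where "w n = 4 * (l + h n)\<^sup>2 - 4 * (d n)\<^sup>2" for n
  have w_lim: "w \<longlonglongrightarrow> 4 * (l + 0)\<^sup>2 - 4 * l\<^sup>2"
    unfolding w_def by (intro tendsto_intros h_lim d_lim)
  have dist_le: "(dist (y n) (y k))\<^sup>2 \<le> w n" if "n \<le> k" for n k
  proof -
    define a where "a = (1 / 2) *\<^sub>R y n + (1 / 2) *\<^sub>R y k"
    have "f a \<le> (1 - 1 / 2) * f (y n) + (1 / 2) * f (y k)"
      using convex_onD[OF cvx, of "1 / 2" "y n" "y k"] by (simp add: a_def)
    also have "\<dots> \<le> m + h n"
      using yC[of n] yC[of k] h_anti[OF that] by (simp add: C_def)
    finally have "d n \<le> norm a" by (intro d_le) (simp add: C_def)
    then have "(d n)\<^sup>2 \<le> (norm a)\<^sup>2" using d_nonneg by (intro power_mono) auto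
    moreover have "(norm (y n))\<^sup>2 \<le> (l + h n)\<^sup>2" "(norm (y k))\<^sup>2 \<le> (l + h n)\<^sup>2"
      using y_le that by (auto intro!: power_mono)
    moreover have "(dist (y n) (y k))\<^sup>2 = 2 * (norm (y n))\<^sup>2 + 2 * (norm (y k))\<^sup>2 - 4 * (norm a)\<^sup>2"
      by (simp add: a_def dist_norm power2_norm_eq_inner inner_add inner_diff algebra_simps inner_commute)
    ultimately show ?thesis by (simp add: w_def)
  qed
  have "Cauchy y"
  proof (rule metric_CauchyI)
    fix e :: real assume "e > 0"
    then have "\<forall>\<^sub>F n in sequentially. w n < (e / 2)\<^sup>2"
      using order_tendstoD(2)[OF w_lim, of "(e/2)\<^sup>2"] by simp
    then obtain N where N: "w N < (e / 2)\<^sup>2" by (auto simp: eventually_sequentially)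
    have near: "dist (y N) (y k) < e / 2" if "N \<le> k" for k
      using dist_le[OF that] N \<open>e > 0\<close> by (intro power2_less_imp_less[of _ "e/2"]) auto
    have "dist (y i) (y j) < e" if "i \<ge> N" "j \<ge> N" for i j
      using near[OF that(1)] near[OF that(2)] dist_triangle3[of "y i" "y j" "y N"] by linarith
    then show "\<exists>M. \<forall>i\<ge>M. \<forall>j\<ge>M. dist (y i) (y j) < e" by blast
  qed
  then obtain p where p_lim: "y \<longlonglongrightarrow> p" using Cauchy_convergent convergent_def by blast
  have "(\<lambda>n. f (y n)) \<longlonglongrightarrow> f p"
    by (rule continuous_on_tendsto_compose[OF cont p_lim]) auto
  moreover have "(\<lambda>n. m + h n) \<longlonglongrightarrow> m + 0" by (intro tendsto_intros h_lim)
  moreover have "f (y n) \<le> m + h n" for n using yC[of n] by (simp add: C_def)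
  ultimately have "f p \<le> m" using LIMSEQ_le[of "\<lambda>n. f (y n)" "f p" "\<lambda>n. m + h n" m] by auto
  with m_le[of p] have fp: "f p = m" by simp
  then have p_min: "p \<in> argmin f" using m_le by (simp add: argmin_iff)
  have "(\<lambda>n. d n + h n) \<longlonglongrightarrow> l + 0" by (intro tendsto_intros h_lim d_lim)
  from LIMSEQ_le[OF tendsto_norm[OF p_lim] this] have "norm p \<le> l"
    using y_less less_imp_le by auto
  moreover have l_le: "l \<le> norm z" if "z \<in> argmin f" for z
    using LIMSEQ_le_const2[OF d_lim] d_le[OF min_in_C[OF that]] by blast
  ultimately have norm_p: "norm p = l" using p_min by (simp add: order_antisym)
  show thesis
  proof
    show "p \<in> argmin f" by (rule p_min)
    show "norm p \<le> norm z" if "z \<in> argmin f" for z using l_le[OF that] norm_p by simp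
    fix e :: real assume "e > 0"
    then have "\<forall>\<^sub>F n in sequentially. (d n)\<^sup>2 > l\<^sup>2 - e"
      by (intro order_tendstoD(1)[OF tendsto_power[OF d_lim]]) simp
    then obtain N where N: "(d N)\<^sup>2 > l\<^sup>2 - e" by (auto simp: eventually_sequentially)
    have "(norm p)\<^sup>2 - e \<le> (norm z)\<^sup>2" if "f z \<le> f p + h N" for z
    proof -
      have "d N \<le> norm z" using that by (intro d_le) (simp add: C_def fp)
      then have "(d N)\<^sup>2 \<le> (norm z)\<^sup>2" using d_nonneg by (intro power_mono) auto
      then show ?thesis using N norm_p by simp
    qed
    then show "\<exists>\<eta>>0. \<forall>y. f y \<le> f p + \<eta> \<longrightarrow> (norm p)\<^sup>2 - e \<le> (norm y)\<^sup>2"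
      using h_pos by blast
  qed
qed

text \<open>
  The facts about the point selected by the choice operator depend on its norm and value only, and
  these agree with those of any minimizer of least norm.
\<close>

lemma min_norm_minimizer_well_posed:
  fixes f :: "'a::{real_inner, complete_space} \<Rightarrow> real"
  assumes "convex_on UNIV f" "continuous_on UNIV f" "argmin f \<noteq> {}"
  defines "p \<equiv> min_norm_minimizer f"
  shows "f p \<le> f y"
    and "e > 0 \<Longrightarrow> \<exists>\<eta>>0. \<forall>y. f y \<le> f p + \<eta> \<longrightarrow> (norm p)\<^sup>2 - e \<le> (norm y)\<^sup>2"
proof -
  obtain p' where p': "p' \<in> argmin f" "\<And>z. z \<in> argmin f \<Longrightarrow> norm p' \<le> norm z"
    "\<And>e. e > 0 \<Longrightarrow> \<exists>\<eta>>0. \<forall>y. f y \<le> f p' + \<eta> \<longrightarrow> (norm p')\<^sup>2 - e \<le> (norm y)\<^sup>2"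
    using least_norm_minimizer_exists_well_posed[OF assms(1-3)] by blast
  have "is_arg_min norm (\<lambda>y. y \<in> argmin f) p'"
    using p' by (force simp: is_arg_min_def)
  then have "is_arg_min norm (\<lambda>y. y \<in> argmin f) p"
    unfolding p_def min_norm_minimizer_def arg_min_on_def arg_min_def by (rule someI)
  then have p: "p \<in> argmin f" "norm p \<le> norm p'"
    using p' by (auto simp: is_arg_min_def not_less)
  then have "norm p = norm p'" using p' by (simp add: order_antisym)
  moreover have "f p = f p'" using p(1) p'(1) by (simp add: argmin_iff order_antisym)
  ultimately show "e > 0 \<Longrightarrow> \<exists>\<eta>>0. \<forall>y. f y \<le> f p + \<eta> \<longrightarrow> (norm p)\<^sup>2 - e \<le> (norm y)\<^sup>2"
    using p'(3) by simp
  show "f p \<le> f y" using p(1) by (simp add: argmin_iff)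
qed

section \<open>Comparison and chain rules\<close>

text \<open>
  The integrating factor \<open>exp (k t\<^bsup>1-r/2\<^esup>)\<close> shows that \<open>H\<close> is at most a constant times
  \<open>exp (- k t\<^bsup>1-r/2\<^esup>)\<close>; as \<open>r < 2\<close>, this decays faster than every power of \<open>t\<close>.
\<close>

lemma stretched_exponential_comparison:
  fixes H H' :: "real \<Rightarrow> real"
  assumes r: "r < 2" and \<theta>: "\<theta> > 0" and \<kappa>: "\<kappa> > 0"
    and ev: "\<forall>\<^sub>F t in at_top. (H has_real_derivative H' t) (at t) \<and> H' t \<le> - \<theta> * t powr (-(r / 2)) * H t"
  shows "\<forall>\<^sub>F t in at_top. H t \<le> \<kappa> * t powr (-r)"
proof -
  define a where "a = 1 - r / 2"
  define k where "k = \<theta> / a"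
  have a: "a > 0" "a - 1 = - (r / 2)" using r by (auto simp: a_def)
  have k: "k > 0" "k * a = \<theta>" using a \<theta> by (auto simp: k_def)
  obtain T where T: "T > 0" and
    HT: "\<And>t. t \<ge> T \<Longrightarrow> (H has_real_derivative H' t) (at t)"
        "\<And>t. t \<ge> T \<Longrightarrow> H' t \<le> - \<theta> * t powr (-(r / 2)) * H t"
    using eventually_conj[OF ev eventually_gt_at_top[of 0]]
    unfolding eventually_at_top_linorder by (metis order_refl)
  define W where "W t = exp (k * t powr a) * H t" for t
  have dW: "(W has_real_derivative exp (k * t powr a) * (\<theta> * t powr (-(r / 2)) * H t + H' t)) (at t)"
    if "t \<ge> T" for t
  proof -
    have "t > 0" using that T by linarith
    have "(W has_real_derivative exp (k * t powr a) * (k * (a * t powr (a - 1))) * H t + exp (k * t powr a) * H' t) (at t)"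
      unfolding W_def using \<open>t > 0\<close> HT(1)[OF that] by (auto intro!: derivative_eq_intros)
    then show ?thesis unfolding mult.assoc[symmetric, of k a] k(2) a(2) by (simp add: algebra_simps)
  qed
  have W_le: "W t \<le> W T" if "t \<ge> T" for t
  proof (rule DERIV_nonpos_imp_nonincreasing[OF that])
    fix s assume "T \<le> s" "s \<le> t"
    then show "\<exists>D. (W has_real_derivative D) (at s) \<and> D \<le> 0"
      using dW[of s] HT(2)[of s] by (intro exI conjI) (auto intro!: mult_nonneg_nonpos)
  qed
  have "((\<lambda>t. t powr r * exp (- (k * t powr a))) \<longlongrightarrow> 0) at_top"
    using a(1) k(1) by real_asymp
  then have "((\<lambda>t. \<bar>W T\<bar> * (t powr r * exp (- (k * t powr a)))) \<longlongrightarrow> \<bar>W T\<bar> * 0) at_top"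
    by (intro tendsto_intros)
  then have "\<forall>\<^sub>F t in at_top. \<bar>W T\<bar> * (t powr r * exp (- (k * t powr a))) < \<kappa>"
    using \<kappa> by (intro order_tendstoD(2)) auto
  then show ?thesis using eventually_ge_at_top[of T]
  proof eventually_elim
    case (elim t)
    then have t: "t > 0" using T by linarith
    have "H t = exp (- (k * t powr a)) * W t" by (simp add: W_def flip: exp_add mult.assoc)
    also have "\<dots> \<le> exp (- (k * t powr a)) * \<bar>W T\<bar>"
      using W_le[OF elim(2)] by (intro mult_left_mono) auto
    also have "\<dots> = (\<bar>W T\<bar> * (t powr r * exp (- (k * t powr a)))) * t powr (-r)"
      using t by (simp add: powr_minus field_simps)
    also have "\<dots> \<le> \<kappa> * t powr (-r)" using elim by (intro mult_right_mono) auto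
    finally show ?case .
  qed
qed


lemma has_real_derivative_norm_power2:
  fixes u :: "real \<Rightarrow> 'a::real_inner"
  assumes "(u has_vector_derivative u') (at t)"
  shows "((\<lambda>t. (norm (u t))\<^sup>2) has_real_derivative 2 * inner (u t) u') (at t)"
proof -
  have "((\<lambda>t. inner (u t) (u t)) has_vector_derivative inner (u t) u' + inner u' (u t)) (at t)"
    by (rule bounded_bilinear.has_vector_derivative[OF bounded_bilinear_inner assms assms])
  then show ?thesis
    by (simp add: power2_norm_eq_inner has_real_derivative_iff_has_vector_derivative inner_commute)
qed

lemma has_real_derivative_along_curve:
  assumes grad: "GDERIV f (x t) :> g" and dx: "(x has_vector_derivative x') (at t)"
  shows "((\<lambda>t. f (x t)) has_real_derivative inner g x') (at t)"
proof -
  have "((\<lambda>t. f (x t)) has_derivative (\<lambda>h. inner (h *\<^sub>R x') g)) (at t)"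
    using has_derivative_compose[OF dx[unfolded has_vector_derivative_def]] grad
    unfolding gderiv_def by blast
  then show ?thesis
    by (rule has_derivative_imp_has_field_derivative) (simp add: inner_commute)
qed

section \<open>The energy of a trajectory\<close>

text \<open>
  Interior times \<open>t > t0\<close> suffice for asymptotics and make all derivatives two-sided. The point \<open>p\<close>
  is an arbitrary minimizer here; that its norm is least enters through the hypothesis of
  \<open>trajectory_tendsto\<close>.
\<close>

locale tikhonov_trajectory =
  fixes f :: "'a::real_inner \<Rightarrow> real" and gradf :: "'a \<Rightarrow> 'a"
    and x x' x'' :: "real \<Rightarrow> 'a" and t0 \<delta> r :: real and p :: 'a
  assumes cvx: "convex_on UNIV f"
    and grad: "GDERIV f y :> gradf y"
    and t0_pos: "t0 > 0" and \<delta>_pos: "\<delta> > 0" and r_pos: "r > 0" and r_less: "r < 2"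
    and velocity: "t > t0 \<Longrightarrow> (x has_vector_derivative x' t) (at t)"
    and acceleration: "t > t0 \<Longrightarrow> (x' has_vector_derivative x'' t) (at t)"
    and ode: "t > t0 \<Longrightarrow>
      x'' t + (\<delta> / t powr (r / 2)) *\<^sub>R x' t + gradf (x t) + (1 / t powr r) *\<^sub>R x t = 0"
    and minimum: "f p \<le> f y"
begin

definition s :: "real \<Rightarrow> real" where
  "s t = t powr (- (r / 2))"

text \<open>
  Half the damping coefficient. With this weight in the energy, the terms \<open>c\<^sup>2 \<langle>u, v\<rangle>\<close> cancel in its
  derivative.
\<close>

definition c :: "real \<Rightarrow> real" where
  "c t = \<delta> / 2 * s t"

text \<open>
  The excess of the regularized function over its value at \<open>p\<close>, which need not be nonnegative.
\<close>

definition gap :: "real \<Rightarrow> real" where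
  "gap t = f (x t) - f p + (s t)\<^sup>2 / 2 * ((norm (x t))\<^sup>2 - (norm p)\<^sup>2)"

definition energy :: "real \<Rightarrow> real" where
  "energy t = gap t + (norm (c t *\<^sub>R (x t - p) + x' t))\<^sup>2 / 2
     + (c t)\<^sup>2 / 2 * (norm (x t - p))\<^sup>2"

text \<open>
  The derivative of the energy along the trajectory, after \<open>x''\<close> has been eliminated. The terms
  with the factor \<open>r/t\<close> come from \<open>s' = - (r/(2t)) s\<close>, the last two from damping and restoring force.
\<close>

definition energy_deriv :: "real \<Rightarrow> real" where
  "energy_deriv t =
     - (r / (2 * t)) * (s t)\<^sup>2 * ((norm (x t))\<^sup>2 - (norm p)\<^sup>2)
     - r / t * (c t)\<^sup>2 * (norm (x t - p))\<^sup>2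
     - r / (2 * t) * c t * inner (x t - p) (x' t)
     - c t * (norm (x' t))\<^sup>2
     - c t * inner (gradf (x t) + (s t)\<^sup>2 *\<^sub>R x t) (x t - p)"

lemma s_pos: "t > 0 \<Longrightarrow> s t > 0"
  by (simp add: s_def)

lemma c_pos: "t > 0 \<Longrightarrow> c t > 0"
  using \<delta>_pos by (simp add: c_def s_pos)

lemma s_power2: "t > 0 \<Longrightarrow> (s t)\<^sup>2 = t powr (- r)"
  by (simp add: s_def power2_eq_square flip: powr_add)

text \<open>
  Because \<open>r < 2\<close>, the relative rate of change \<open>1/t\<close> of the coefficients is negligible
  against the relaxation rate, which is proportional to \<open>s\<close>.
\<close>

lemma inverse_time_eventually_small:
  assumes e: "e > 0"
  shows "\<forall>\<^sub>F t in at_top. 1 / t \<le> e * s t"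
proof -
  have "((\<lambda>t. t powr (r / 2 - 1)) \<longlongrightarrow> 0) at_top"
    using r_less by real_asymp
  then have "\<forall>\<^sub>F t in at_top. t powr (r / 2 - 1) < e"
    using e by (rule order_tendstoD)
  then show ?thesis using eventually_gt_at_top[of 0]
  proof eventually_elim
    case (elim t)
    then have "1 / t = t powr (r / 2 - 1) * s t"
      by (simp add: s_def powr_minus_divide powr_diff)
    also have "\<dots> \<le> e * s t" using elim s_pos[of t] by (intro mult_right_mono) auto
    finally show ?case .
  qed
qed

lemma acceleration_eq:
  assumes "t > t0"
  shows "x'' t = - (2 * c t) *\<^sub>R x' t - (gradf (x t) + (s t)\<^sup>2 *\<^sub>R x t)"
proof -
  have t: "t > 0" using assms t0_pos by linarith
  have "\<delta> / t powr (r / 2) = 2 * c t" by (simp add: c_def s_def powr_minus_divide)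
  moreover have "1 / t powr r = (s t)\<^sup>2" using t by (simp add: s_power2 powr_minus_divide)
  ultimately show ?thesis
    using ode[OF assms] by (simp add: algebra_simps eq_neg_iff_add_eq_0)
qed

lemma s_deriv:
  assumes "t > 0"
  shows "(s has_real_derivative - (r / (2 * t)) * s t) (at t)"
proof -
  have "(s has_real_derivative - (r / 2) * t powr (- (r / 2) - 1)) (at t)"
    unfolding s_def using assms by (auto intro!: derivative_eq_intros)
  moreover have "t powr (- (r / 2) - 1) = s t / t"
    using assms by (simp add: s_def powr_diff)
  ultimately show ?thesis by simp
qed

lemma energy_has_derivative:
  assumes "t > t0"
  shows "(energy has_real_derivative energy_deriv t) (at t)"
proof -
  have t: "t > 0" using assms t0_pos by linarith
  define u where "u = x t - p"
  define g where "g = gradf (x t) + (s t)\<^sup>2 *\<^sub>R x t"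
  define c' where "c' = - (r / (2 * t)) * c t"
  have ds: "(s has_real_derivative - (r / (2 * t)) * s t) (at t)" by (rule s_deriv[OF t])
  have dc: "(c has_real_derivative c') (at t)"
    unfolding c_def c'_def by (rule derivative_eq_intros ds refl | simp)+
  have du: "((\<lambda>t. x t - p) has_vector_derivative x' t) (at t)"
    using velocity[OF assms] by (auto intro!: derivative_eq_intros)
  have dw: "((\<lambda>t. c t *\<^sub>R (x t - p) + x' t) has_vector_derivative
      (c t *\<^sub>R x' t + c' *\<^sub>R u) + x'' t) (at t)"
    unfolding u_def
    by (intro has_vector_derivative_add has_vector_derivative_scaleR dc du acceleration assms)
  have gradf_v: "inner (gradf (x t)) (x' t) = inner g (x' t) - (s t)\<^sup>2 * inner (x t) (x' t)"
    by (simp add: g_def inner_add_left)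
  have x''_eq: "x'' t = - (2 * c t) *\<^sub>R x' t - g"
    using acceleration_eq[OF assms] by (simp add: g_def)
  have kinetic: "inner (c t *\<^sub>R u + x' t) ((c t *\<^sub>R x' t + c' *\<^sub>R u) + x'' t)
      = c t * c' * (norm u)\<^sup>2 - (c t)\<^sup>2 * inner u (x' t) + c' * inner u (x' t)
        - c t * (norm (x' t))\<^sup>2 - c t * inner g u - inner g (x' t)"
    unfolding x''_eq power2_norm_eq_inner
    by (simp add: power2_eq_square inner_add inner_diff inner_commute algebra_simps)
  have "(energy has_real_derivative
      inner (gradf (x t)) (x' t)
      + (s t * (- (r / (2 * t)) * s t) * ((norm (x t))\<^sup>2 - (norm p)\<^sup>2)
         + (s t)\<^sup>2 / 2 * (2 * inner (x t) (x' t)))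
      + inner (c t *\<^sub>R u + x' t) ((c t *\<^sub>R x' t + c' *\<^sub>R u) + x'' t)
      + (c t * c' * (norm u)\<^sup>2 + (c t)\<^sup>2 / 2 * (2 * inner u (x' t)))) (at t)"
    unfolding energy_def gap_def u_def
    by (rule derivative_eq_intros ds dc refl has_real_derivative_norm_power2[OF dw]
        has_real_derivative_norm_power2[OF velocity[OF assms]]
        has_real_derivative_norm_power2[OF du]
        has_real_derivative_along_curve[where x = x, OF grad velocity[OF assms]]
      | simp add: u_def power2_eq_square)+
  then show ?thesis
    unfolding energy_deriv_def gradf_v kinetic u_def[symmetric] g_def[symmetric]
    by (elim DERIV_cong) (simp add: c'_def power2_eq_square field_simps)
qed

text \<open>
  Strong convexity of the regularized function, compared at \<open>x\<close> and \<open>p\<close>: the tangent inequality for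
  \<open>f\<close> and an exact expansion of the quadratic part.
\<close>

lemma gap_tangent_bound:
  "gap t + (s t)\<^sup>2 / 2 * (norm (x t - p))\<^sup>2 \<le> inner (gradf (x t) + (s t)\<^sup>2 *\<^sub>R x t) (x t - p)"
proof -
  have "f (x t) - f p \<le> inner (gradf (x t)) (x t - p)"
    using convex_gradient_inequality[OF cvx grad, of "x t" p] by (simp add: inner_diff_right)
  moreover
  have "inner (x t) (x t - p) = ((norm (x t))\<^sup>2 - (norm p)\<^sup>2) / 2 + (norm (x t - p))\<^sup>2 / 2"
    by (simp add: power2_norm_eq_inner inner_diff inner_commute field_simps)
  then have "(s t)\<^sup>2 * inner (x t) (x t - p)
      = (s t)\<^sup>2 / 2 * ((norm (x t))\<^sup>2 - (norm p)\<^sup>2) + (s t)\<^sup>2 / 2 * (norm (x t - p))\<^sup>2"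
    by (simp only:) (simp add: algebra_simps add_divide_distrib diff_divide_distrib)
  ultimately show ?thesis
    unfolding gap_def inner_add_left inner_scaleR_left by linarith
qed

lemma energy_lower: "gap t + (c t)\<^sup>2 / 2 * (norm (x t - p))\<^sup>2 \<le> energy t"
  by (simp add: energy_def)

lemma energy_upper:
  "energy t \<le> gap t + (norm (x' t))\<^sup>2 + 3 / 8 * \<delta>\<^sup>2 * ((s t)\<^sup>2 * (norm (x t - p))\<^sup>2)"
proof -
  define a where "a = c t *\<^sub>R (x t - p)"
  have "(norm (a + x' t))\<^sup>2 + (norm (a - x' t))\<^sup>2 = 2 * (norm a)\<^sup>2 + 2 * (norm (x' t))\<^sup>2"
    by (simp add: power2_norm_eq_inner inner_add inner_diff)
  then have "(norm (a + x' t))\<^sup>2 / 2 \<le> (norm a)\<^sup>2 + (norm (x' t))\<^sup>2"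
    by (smt (verit) zero_le_power2 field_sum_of_halves)
  moreover have "(norm a)\<^sup>2 = \<delta>\<^sup>2 / 4 * ((s t)\<^sup>2 * (norm (x t - p))\<^sup>2)"
    "(c t)\<^sup>2 / 2 * (norm (x t - p))\<^sup>2 = \<delta>\<^sup>2 / 8 * ((s t)\<^sup>2 * (norm (x t - p))\<^sup>2)"
    by (simp_all add: a_def c_def power_mult_distrib power_divide)
  ultimately show ?thesis unfolding energy_def a_def[symmetric] by linarith
qed

text \<open>
  The fraction of the dissipation that is spent on controlling the energy. It is small enough for
  \<open>q E\<close> to be dominated by \<open>q G + s\<^sup>2 |u|\<^sup>2/4 + 3 |v|\<^sup>2/4\<close>, given \<open>energy_upper\<close>.
\<close>

definition q :: real where
  "q = 1 / (2 + 2 * \<delta>\<^sup>2)"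

lemma q_bounds: "0 < q" "q \<le> 1 / 2" "q * (3 / 8 * \<delta>\<^sup>2) \<le> 1 / 4"
  using \<delta>_pos by (auto simp: q_def field_simps add_pos_nonneg)

text \<open>
  Damping and strong convexity give \<open>- c (G + s\<^sup>2 |u|\<^sup>2/2 + |v|\<^sup>2)\<close>. The term in \<open>\<langle>u, v\<rangle>\<close> left over from the
  variation of \<open>c\<close> costs at most \<open>c (s\<^sup>2 |u|\<^sup>2 + |v|\<^sup>2)/4\<close> once \<open>t\<close> is large. The quadratic terms that
  remain pay for \<open>q E\<close>, but only for a part of \<open>G\<close>, whose sign is unknown; hence the separate
  \<open>G\<close>-term. The decrease of \<open>s\<close> contributes the forcing term with \<open>|p|\<^sup>2\<close>.
\<close>

lemma energy_dissipation:
  assumes t: "t > 0" and late: "1 / t \<le> 1 / 2 * s t"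
  shows "energy_deriv t \<le> - q * c t * energy t - (1 - q) * c t * gap t
    + r / (2 * t) * (s t)\<^sup>2 * (norm p)\<^sup>2"
proof -
  define U where "U = (s t)\<^sup>2 * (norm (x t - p))\<^sup>2"
  define V where "V = (norm (x' t))\<^sup>2"
  note pos = s_pos[OF t] c_pos[OF t]
  have UV: "U \<ge> 0" "V \<ge> 0" by (auto simp: U_def V_def)
  have cross: "- (r / (2 * t) * c t * inner (x t - p) (x' t)) \<le> c t * (U / 4 + V / 4)"
  proof -
    have "\<bar>inner (x t - p) (x' t)\<bar> \<le> norm (x t - p) * norm (x' t)"
      by (rule Cauchy_Schwarz_ineq2)
    moreover have "r / (2 * t) \<le> 1 / t" using r_less t by (simp add: field_simps)
    with late have rt: "r / (2 * t) \<le> 1 / 2 * s t" by linarith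
    moreover have "0 \<le> r / (2 * t)" using r_pos t by simp
    ultimately have "r / (2 * t) * \<bar>inner (x t - p) (x' t)\<bar>
        \<le> 1 / 2 * s t * (norm (x t - p) * norm (x' t))"
      using pos by (intro mult_mono) auto
    also have "\<dots> \<le> U / 4 + V / 4"
      using zero_le_power2[of "s t * norm (x t - p) - norm (x' t)"]
      by (simp add: U_def V_def power2_diff power_mult_distrib)
    finally have "r / (2 * t) * \<bar>inner (x t - p) (x' t)\<bar> \<le> U / 4 + V / 4" .
    moreover have "- (r / (2 * t) * inner (x t - p) (x' t)) \<le> r / (2 * t) * \<bar>inner (x t - p) (x' t)\<bar>"
      using mult_left_mono[OF abs_ge_minus_self \<open>0 \<le> r / (2 * t)\<close>] by simp
    ultimately have "c t * - (r / (2 * t) * inner (x t - p) (x' t)) \<le> c t * (U / 4 + V / 4)"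
      using pos by (intro mult_left_mono) auto
    then show ?thesis by (simp add: mult_ac)
  qed
  have "c t * (gap t + U / 2) \<le> c t * inner (gradf (x t) + (s t)\<^sup>2 *\<^sub>R x t) (x t - p)"
    using gap_tangent_bound[of t] pos by (intro mult_left_mono) (auto simp: U_def)
  moreover have "0 \<le> r / t * (c t)\<^sup>2 * (norm (x t - p))\<^sup>2" "0 \<le> r / (2 * t) * (s t)\<^sup>2 * (norm (x t))\<^sup>2"
    using r_pos t by auto
  ultimately have "energy_deriv t \<le> r / (2 * t) * (s t)\<^sup>2 * (norm p)\<^sup>2
      - c t * (gap t + U / 2) - c t * V + c t * (U / 4 + V / 4)"
    using cross unfolding energy_deriv_def V_def[symmetric] by (simp only: right_diff_distrib)
  moreover have "q * energy t \<le> q * gap t + U / 4 + 3 / 4 * V"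
  proof -
    have "q * energy t \<le> q * (gap t + V + 3 / 8 * \<delta>\<^sup>2 * U)"
      using energy_upper[of t] q_bounds(1) by (intro mult_left_mono) (auto simp: U_def V_def)
    moreover have "q * (3 / 8 * \<delta>\<^sup>2) * U \<le> 1 / 4 * U" "q * V \<le> 3 / 4 * V"
      using mult_right_mono[OF q_bounds(3) UV(1)] mult_right_mono[of q "3 / 4" V] q_bounds(2) UV(2)
      by auto
    ultimately show ?thesis by (simp add: algebra_simps)
  qed
  then have "c t * (q * energy t) \<le> c t * (q * gap t + U / 4 + 3 / 4 * V)"
    using pos by (intro mult_left_mono) auto
  ultimately show ?thesis by (simp add: algebra_simps)
qed

text \<open>
  Under the lower bound on \<open>G\<close> the dissipation inequality becomes \<open>E' \<le> - q c E + 2 \<kappa> c s\<^sup>2\<close> for large \<open>t\<close>.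
  The level \<open>M s\<^sup>2\<close> with \<open>q M = 4 \<kappa>\<close> is a supersolution: of the factor \<open>4\<close>, one unit absorbs the
  \<open>G\<close>-term, one the forcing term, one the decrease of \<open>M s\<^sup>2\<close> itself, and one is spare. So \<open>E - M s\<^sup>2\<close>
  satisfies the linear inequality of \<open>stretched_exponential_comparison\<close>. The constant in front of \<open>\<kappa>\<close>
  does not depend on \<open>\<kappa>\<close>, which lets \<open>\<kappa>\<close> tend to \<open>0\<close> later.
\<close>

lemma energy_eventually_le:
  assumes \<kappa>: "\<kappa> > 0" and gap: "\<forall>\<^sub>F t in at_top. gap t \<ge> - \<kappa> * (s t)\<^sup>2"
  shows "\<forall>\<^sub>F t in at_top. energy t \<le> (4 / q + 1) * \<kappa> * (s t)\<^sup>2"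
proof -
  define M where "M = 4 * \<kappa> / q"
  define D where "D = (norm p)\<^sup>2"
  define H where "H t = energy t - M * (s t)\<^sup>2" for t
  define H' where "H' t = energy_deriv t + M * (r / t) * (s t)\<^sup>2" for t
  have q: "q > 0" "q \<le> 1 / 2" using q_bounds by auto
  have M: "M > 0" "q * M = 4 * \<kappa>" using \<kappa> q by (auto simp: M_def)
  have D: "D \<ge> 0" by (simp add: D_def)
  have small: "\<forall>\<^sub>F t in at_top. C / t \<le> \<kappa> * c t" if "C \<ge> 0" for C
  proof -
    define K where "K = C + 1"
    have K: "K > 0" using that by (simp add: K_def)
    have "\<kappa> * \<delta> / (2 * K) > 0" using \<kappa> \<delta>_pos K by simp
    from inverse_time_eventually_small[OF this] eventually_gt_at_top[of 0] show ?thesis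
    proof eventually_elim
      case (elim t)
      have "C / t \<le> K * (1 / t)" using elim by (simp add: K_def field_simps)
      also have "\<dots> \<le> K * (\<kappa> * \<delta> / (2 * K) * s t)"
        using elim K by (intro mult_left_mono) auto
      also have "\<dots> = \<kappa> * c t" using K by (simp add: c_def)
      finally show ?case .
    qed
  qed
  have rD: "r * D / 2 \<ge> 0" and rM: "r * M \<ge> 0" using r_pos D M by auto
  have "\<forall>\<^sub>F t in at_top. (H has_real_derivative H' t) (at t) \<and>
      H' t \<le> - (q * \<delta> / 2) * t powr (-(r / 2)) * H t"
    using gap eventually_gt_at_top[of t0] inverse_time_eventually_small[of "1 / 2", simplified]
      small[OF rD] small[OF rM]
  proof eventually_elim
    case (elim t)
    then have t: "t > 0" using t0_pos by linarith
    have pos: "s t > 0" "c t > 0" using t by (auto simp: s_pos c_pos)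
    have "(H has_real_derivative energy_deriv t - M * (2 * s t * (- (r / (2 * t)) * s t))) (at t)"
      unfolding H_def
      by (rule derivative_eq_intros energy_has_derivative s_deriv refl elim t | simp)+
    then have dH: "(H has_real_derivative H' t) (at t)"
      by (simp add: H'_def power2_eq_square mult_ac)
    have "- ((1 - q) * c t * gap t) \<le> (1 - q) * c t * (\<kappa> * (s t)\<^sup>2)"
      using mult_left_mono[OF elim(1), of "(1 - q) * c t"] pos q by (simp add: algebra_simps)
    also have "\<dots> \<le> 1 * c t * (\<kappa> * (s t)\<^sup>2)"
      using pos q \<kappa> by (intro mult_right_mono) auto
    finally have g: "- ((1 - q) * c t * gap t) \<le> c t * \<kappa> * (s t)\<^sup>2" by simp
    have d: "r / (2 * t) * (s t)\<^sup>2 * D \<le> \<kappa> * c t * (s t)\<^sup>2"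
      using mult_right_mono[OF elim(4), of "(s t)\<^sup>2"]
      by (simp add: mult_ac)
    have m: "M * (r / t) * (s t)\<^sup>2 \<le> \<kappa> * c t * (s t)\<^sup>2"
      using mult_right_mono[OF elim(5), of "(s t)\<^sup>2"] by (simp add: mult_ac)
    have "energy_deriv t \<le> - q * c t * energy t - (1 - q) * c t * gap t + r / (2 * t) * (s t)\<^sup>2 * D"
      unfolding D_def by (rule energy_dissipation[OF t]) (use elim(3) in simp)
    then have "H' t \<le> - q * c t * energy t + 3 * (\<kappa> * c t * (s t)\<^sup>2)"
      using g d m unfolding H'_def by (simp add: mult_ac)
    also have "\<dots> \<le> - q * c t * energy t + (q * M) * (c t * (s t)\<^sup>2)"
      using pos \<kappa> by (simp add: M(2))
    also have "\<dots> = - (q * \<delta> / 2) * t powr (-(r / 2)) * H t"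
      by (simp add: H_def c_def s_def[symmetric] algebra_simps)
    finally show ?case using dH by blast
  qed
  from stretched_exponential_comparison[OF r_less _ \<kappa> this]
  have "\<forall>\<^sub>F t in at_top. H t \<le> \<kappa> * t powr (- r)" using q \<delta>_pos by simp
  then show ?thesis using eventually_gt_at_top[of 0]
    by eventually_elim (simp add: H_def M_def s_power2 algebra_simps)
qed

section \<open>Convergence of values and of the trajectory\<close>

lemma gap_ge: "gap t \<ge> (s t)\<^sup>2 / 2 * ((norm (x t))\<^sup>2 - (norm p)\<^sup>2)"
  using minimum[of "x t"] by (simp add: gap_def)

text \<open>
  The bound \<open>G \<ge> - s\<^sup>2 |p|\<^sup>2/2\<close> is free. The summand \<open>1\<close> in \<open>\<kappa>\<close> keeps it positive when \<open>p = 0\<close>.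
\<close>

lemma values_bigo: "(\<lambda>t. f (x t) - f p) \<in> O[at_top](\<lambda>t. t powr (- r))"
proof -
  define \<kappa> where "\<kappa> = (norm p)\<^sup>2 / 2 + 1"
  have \<kappa>: "\<kappa> > 0" by (simp add: \<kappa>_def add_nonneg_pos)
  have "gap t \<ge> - \<kappa> * (s t)\<^sup>2" for t
  proof -
    have "(s t)\<^sup>2 * (- \<kappa>) \<le> (s t)\<^sup>2 * (((norm (x t))\<^sup>2 - (norm p)\<^sup>2) / 2)"
    proof (intro mult_left_mono)
      show "- \<kappa> \<le> ((norm (x t))\<^sup>2 - (norm p)\<^sup>2) / 2"
        by (simp add: \<kappa>_def field_simps) (rule order_trans[of _ 0]; simp)
    qed simp
    then show ?thesis using gap_ge[of t] by (simp add: mult_ac)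
  qed
  from energy_eventually_le[OF \<kappa> always_eventually[OF allI[OF this]]]
  have "\<forall>\<^sub>F t in at_top. energy t \<le> (4 / q + 1) * \<kappa> * (s t)\<^sup>2" .
  then have "\<forall>\<^sub>F t in at_top. norm (f (x t) - f p) \<le> ((4 / q + 1) * \<kappa> + (norm p)\<^sup>2 / 2) * norm (t powr (- r))"
    using eventually_gt_at_top[of 0]
  proof eventually_elim
    case (elim t)
    have nonneg: "0 \<le> (c t)\<^sup>2 / 2 * (norm (x t - p))\<^sup>2" "0 \<le> (s t)\<^sup>2 * (norm (x t))\<^sup>2" by auto
    have "f (x t) - f p \<le> energy t + (s t)\<^sup>2 * ((norm p)\<^sup>2 / 2)"
    proof -
      have "gap t = f (x t) - f p + (s t)\<^sup>2 * (norm (x t))\<^sup>2 / 2 - (s t)\<^sup>2 * ((norm p)\<^sup>2 / 2)"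
        by (simp add: gap_def algebra_simps diff_divide_distrib)
      with nonneg show ?thesis using energy_lower[of t] by linarith
    qed
    then show ?case
      using elim minimum[of "x t"] by (simp add: s_power2 algebra_simps)
  qed
  then show ?thesis by (rule bigoI)
qed

text \<open>
  By the rate for the values, \<open>x(t)\<close> enters every set \<open>{y. f y \<le> f p + \<eta>}\<close>, where the hypothesis bounds
  \<open>|x|\<^sup>2 - |p|\<^sup>2\<close> from below by an arbitrarily small negative number. This improves the bound on \<open>G\<close> to
  \<open>- \<kappa> s\<^sup>2\<close> for every \<open>\<kappa> > 0\<close>, and then \<open>c\<^sup>2 |u|\<^sup>2/2 \<le> E - G\<close> is at most a constant times \<open>\<kappa> s\<^sup>2\<close>.
\<close>

lemma trajectory_tendsto:
  assumes well_posed: "\<And>e. e > 0 \<Longrightarrow> \<exists>\<eta>>0. \<forall>y. f y \<le> f p + \<eta> \<longrightarrow> (norm p)\<^sup>2 - e \<le> (norm y)\<^sup>2"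
  shows "((\<lambda>t. norm (x t - p)) \<longlongrightarrow> 0) at_top"
proof -
  have "(\<lambda>t::real. t powr (- r)) \<in> o[at_top](\<lambda>_. 1 :: real)" using r_pos by real_asymp
  then have "((\<lambda>t. f (x t) - f p) \<longlongrightarrow> 0) at_top"
    using landau_o.big_small_trans[OF values_bigo] smalloD_tendsto by fastforce
  then have near_min: "\<forall>\<^sub>F t in at_top. f (x t) - f p < \<eta>" if "\<eta> > 0" for \<eta>
    using that by (rule order_tendstoD)
  define K where "K = (4 / q + 2) * 8 / \<delta>\<^sup>2"
  have K: "K > 0" using q_bounds(1) \<delta>_pos by (simp add: K_def add_pos_pos)
  have close: "\<forall>\<^sub>F t in at_top. (norm (x t - p))\<^sup>2 \<le> K * \<kappa>" if \<kappa>: "\<kappa> > 0" for \<kappa>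
  proof -
    obtain \<eta> where \<eta>: "\<eta> > 0" "\<And>y. f y \<le> f p + \<eta> \<Longrightarrow> (norm p)\<^sup>2 - 2 * \<kappa> \<le> (norm y)\<^sup>2"
      using well_posed[of "2 * \<kappa>"] \<kappa> by auto
    have gap: "\<forall>\<^sub>F t in at_top. gap t \<ge> - \<kappa> * (s t)\<^sup>2"
      using near_min[OF \<eta>(1)]
    proof eventually_elim
      case (elim t)
      then have "(norm p)\<^sup>2 - 2 * \<kappa> \<le> (norm (x t))\<^sup>2" by (intro \<eta>(2)) simp
      then have "(s t)\<^sup>2 * (- \<kappa>) \<le> (s t)\<^sup>2 * (((norm (x t))\<^sup>2 - (norm p)\<^sup>2) / 2)"
        by (intro mult_left_mono) auto
      then show ?case using gap_ge[of t] by (simp add: mult_ac)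
    qed
    show ?thesis
      using gap energy_eventually_le[OF \<kappa> gap] eventually_gt_at_top[of 0]
    proof eventually_elim
      case (elim t)
      have "(s t)\<^sup>2 * (\<delta>\<^sup>2 / 8 * (norm (x t - p))\<^sup>2) = (c t)\<^sup>2 / 2 * (norm (x t - p))\<^sup>2"
        by (simp add: c_def power2_eq_square)
      also have "\<dots> \<le> (s t)\<^sup>2 * ((4 / q + 2) * \<kappa>)"
      proof -
        have "(s t)\<^sup>2 * ((4 / q + 2) * \<kappa>) = (4 / q + 1) * \<kappa> * (s t)\<^sup>2 + \<kappa> * (s t)\<^sup>2"
          by (simp add: algebra_simps)
        then show ?thesis using elim energy_lower[of t] by linarith
      qed
      finally have "\<delta>\<^sup>2 / 8 * (norm (x t - p))\<^sup>2 \<le> (4 / q + 2) * \<kappa>"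
        using s_pos[OF elim(3)] by simp
      then show ?case using \<delta>_pos by (simp add: K_def field_simps)
    qed
  qed
  show ?thesis
  proof (rule tendstoI)
    fix e :: real assume e: "e > 0"
    then have "e\<^sup>2 / (2 * K) > 0" using K by simp
    from close[OF this] show "\<forall>\<^sub>F t in at_top. dist (norm (x t - p)) 0 < e"
    proof eventually_elim
      case (elim t)
      also have "K * (e\<^sup>2 / (2 * K)) < e\<^sup>2" using K e by simp
      finally show ?case using e by (simp add: power_less_imp_less_base)
    qed
  qed
qed

end

section \<open>Rate of the values and convergence to the minimizer of least norm\<close>

theorem theorem3:
  fixes f :: "'a::{real_inner, complete_space} \<Rightarrow> real"
    and gradf :: "'a \<Rightarrow> 'a"
    and x :: "real \<Rightarrow> 'a"
    and t0 \<delta> r :: real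
  assumes "convex_on UNIV f"
    and "\<And>y. GDERIV f y :> gradf y"
    and "\<And>B. bounded B \<Longrightarrow> \<exists>L. L-lipschitz_on B gradf"
    and "argmin f \<noteq> {}"
    and "t0 > 0" and "\<delta> > 0" and "2 / 3 < r" and "r < 2"
    and "solution_trajectory gradf \<delta> r t0 x"
  shows "(\<lambda>t. f (x t) - (INF y. f y)) \<in> O[at_top](\<lambda>t. 1 / t powr (3 * r / 2 - 1)) \<and>
         Liminf at_top (\<lambda>t. ereal (norm (x t - min_norm_minimizer f))) = 0"
proof -
  define p where "p = min_norm_minimizer f"
  have "continuous_on UNIV f"
    using assms(2) unfolding gderiv_def
    by (intro continuous_at_imp_continuous_on ballI has_derivative_continuous) blast
  note p = min_norm_minimizer_well_posed[OF assms(1) this assms(4), folded p_def]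
  obtain x' x'' where sol: "\<And>t. t \<ge> t0 \<Longrightarrow>
      (x has_vector_derivative x' t) (at t within {t0..}) \<and>
      (x' has_vector_derivative x'' t) (at t within {t0..}) \<and>
      x'' t + (\<delta> / t powr (r / 2)) *\<^sub>R x' t + gradf (x t) + (1 / t powr r) *\<^sub>R x t = 0"
    using assms(9) unfolding solution_trajectory_def by blast
  have at_interior: "at t within {t0..} = at t" if "t > t0" for t
    using that by (intro at_within_interior) simp
  interpret tikhonov_trajectory f gradf x x' x'' t0 \<delta> r p
  proof
    fix t assume t: "t > t0"
    show "(x has_vector_derivative x' t) (at t)" "(x' has_vector_derivative x'' t) (at t)"
      using sol[of t] t at_interior[OF t] by auto
    show "x'' t + (\<delta> / t powr (r / 2)) *\<^sub>R x' t + gradf (x t) + (1 / t powr r) *\<^sub>R x t = 0"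
      using sol[of t] t by auto
  qed (use assms p(1) in auto)
  have "(INF y. f y) = f p"
    using p(1) by (intro cInf_eq_minimum) auto
  moreover have "(\<lambda>t. t powr (- r)) \<in> O[at_top](\<lambda>t. 1 / t powr (3 * r / 2 - 1))"
    using assms(8) by real_asymp
  ultimately have "(\<lambda>t. f (x t) - (INF y. f y)) \<in> O[at_top](\<lambda>t. 1 / t powr (3 * r / 2 - 1))"
    using landau_o.big_trans[OF values_bigo] by simp
  moreover have "((\<lambda>t. ereal (norm (x t - p))) \<longlongrightarrow> ereal 0) at_top"
    using trajectory_tendsto[OF p(2)] by (intro tendsto_intros) auto
  then have "Liminf at_top (\<lambda>t. ereal (norm (x t - p))) = ereal 0"
    by (rule lim_imp_Liminf[OF trivial_limit_at_top_linorder])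
  ultimately show ?thesis by (simp add: p_def zero_ereal_def)
qed

end
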